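(* Let $I=(X,\mathcal{D},R)$ be a binary CSP instance and let $b \in \mathcal{D}(x_i)$ for some variable $x_i$ of $I$. If $b$ is snake-conditioned snake-substitutable (SCSS), then $b$ can be eliminated from $\mathcal{D}(x_i)$ without changing the satisfiability of the instance; that is, $I$ has a solution if and only if the instance obtained from $I$ by replacing $\mathcal{D}(x_i)$ by $\mathcal{D}(x_i)\setminus\{b\}$ (and restricting the constraint relations accordingly) has a solution.
   Context: A binary CSP instance $I=(X,\mathcal{D},R)$ consists of a set $X$ of $n$ variables $x_1,\ldots,x_n$, a finite domain $\mathcal{D}(x_i)$ for each variable $x_i$, and a binary constraint relation $R_{ij} \subseteq \mathcal{D}(x_i)\times\mathcal{D}(x_j)$ for each pair of distinct variables $x_i,x_j$, where $R_{ji}$ is always the transpose of $R_{ij}$. If $x_i$ and $x_j$ do not constrain each other then $R_{ij}=\mathcal{D}(x_i)\times\mathcal{D}(x_j)$. A solution is an $n$-tuple $\langle s_1,\ldots,s_n\rangle$ with $s_i\in\mathcal{D}(x_i)$ for all $i$ and $(s_i,s_j)\in R_{ij}$ for all distinct $i,j$. An instance is satisfiable if it has a solution. Indices such as $j,k,\ell,m$ range over $\{1,\ldots,n\}$. For $a,b\in\mathcal{D}(x_i)$ and $j\neq i$, write $b \xrightarrow{ij} a$ if for all $c\in\mathcal{D}(x_j)$, $(b,c)\in R_{ij}$ implies $(a,c)\in R_{ij}$. For $a,b\in\mathcal{D}(x_i)$ and $k\neq i$, write $b \overset{ik}{\rightsquigarrow} a$ if for all $d\in\mathcal{D}(x_k)$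 with $(b,d)\in R_{ik}$ there exists $e\in\mathcal{D}(x_k)$ such that $(a,e)\in R_{ik}$ and, for all $\ell\notin\{i,k\}$, $d\xrightarrow{k\ell} e$. A value $b\in\mathcal{D}(x_i)$ is snake-conditioned snake-substitutable (SCSS) if for some $j\neq i$, for all $c\in\mathcal{D}(x_j)$ with $(b,c)\in R_{ij}$, there exists $a\in\mathcal{D}(x_i)\setminus\{b\}$ such that: (i) for all $k\notin\{i,j\}$, $b\overset{ik}{\rightsquigarrow}a$; and (ii) there exists $g\in\mathcal{D}(x_j)$ with $(a,g)\in R_{ij}$ and, for all $m\notin\{i,j\}$, $c\xrightarrow{jm}g$. *)

theory Defs
  imports Main "HOL-Library.FuncSet"
begin

text \<open>Domains of different variables may differ (and may overlap); all of them are subsets of one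
  type of values. Only the entries \<open>csp_dom I i\<close> with \<open>i \<in> csp_vars I\<close> and \<open>csp_rel I i j\<close> with
  distinct \<open>i, j \<in> csp_vars I\<close> are meaningful.\<close>

record 'a csp =
  csp_size :: nat
  csp_dom :: "nat \<Rightarrow> 'a set"
  csp_rel :: "nat \<Rightarrow> nat \<Rightarrow> ('a \<times> 'a) set"

definition csp_vars :: "'a csp \<Rightarrow> nat set" where
  "csp_vars I = {1..csp_size I}"

definition binary_csp :: "'a csp \<Rightarrow> bool" where
  "binary_csp I \<longleftrightarrow>
     (\<forall>i\<in>csp_vars I. finite (csp_dom I i)) \<and>
     (\<forall>i\<in>csp_vars I. \<forall>j\<in>csp_vars I - {i}.
        csp_rel I i j \<subseteq> csp_dom I i \<times> csp_dom I j \<and>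
        csp_rel I j i = (csp_rel I i j)\<inverse>)"

text \<open>An \<open>n\<close>-tuple is an extensional function on \<open>{1..n}\<close>.\<close>

definition csp_solution :: "'a csp \<Rightarrow> (nat \<Rightarrow> 'a) \<Rightarrow> bool" where
  "csp_solution I s \<longleftrightarrow>
     s \<in> (\<Pi>\<^sub>E i\<in>csp_vars I. csp_dom I i) \<and>
     (\<forall>i\<in>csp_vars I. \<forall>j\<in>csp_vars I - {i}. (s i, s j) \<in> csp_rel I i j)"

definition satisfiable :: "'a csp \<Rightarrow> bool" where
  "satisfiable I \<longleftrightarrow> (\<exists>s. csp_solution I s)"

definition eliminate :: "'a csp \<Rightarrow> nat \<Rightarrow> 'a \<Rightarrow> 'a csp" where
  "eliminate I i b =
     (let D' = (csp_dom I)(i := csp_dom I i - {b})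
      in I\<lparr>csp_dom := D', csp_rel := (\<lambda>k l. csp_rel I k l \<inter> (D' k \<times> D' l))\<rparr>)"

text \<open>\<open>arrow I i j b a\<close> is $b \xrightarrow{ij} a$ and \<open>snake I i k b a\<close> is
  $b \overset{ik}{\rightsquigarrow} a$. They are meant for \<open>a, b \<in> csp_dom I i\<close> and a second variable
  different from \<open>i\<close>; these side conditions hold wherever the relations are used below.\<close>

definition arrow :: "'a csp \<Rightarrow> nat \<Rightarrow> nat \<Rightarrow> 'a \<Rightarrow> 'a \<Rightarrow> bool" where
  "arrow I i j b a \<longleftrightarrow>
     (\<forall>c\<in>csp_dom I j. (b, c) \<in> csp_rel I i j \<longrightarrow> (a, c) \<in> csp_rel I i j)"

definition snake :: "'a csp \<Rightarrow> nat \<Rightarrow> nat \<Rightarrow> 'a \<Rightarrow> 'a \<Rightarrow> bool" where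
  "snake I i k b a \<longleftrightarrow>
     (\<forall>d\<in>csp_dom I k. (b, d) \<in> csp_rel I i k \<longrightarrow>
        (\<exists>e\<in>csp_dom I k. (a, e) \<in> csp_rel I i k \<and>
           (\<forall>l\<in>csp_vars I - {i, k}. arrow I k l d e)))"

definition SCSS :: "'a csp \<Rightarrow> nat \<Rightarrow> 'a \<Rightarrow> bool" where
  "SCSS I i b \<longleftrightarrow>
     (\<exists>j\<in>csp_vars I - {i}. \<forall>c\<in>csp_dom I j. (b, c) \<in> csp_rel I i j \<longrightarrow>
        (\<exists>a\<in>csp_dom I i - {b}.
           (\<forall>k\<in>csp_vars I - {i, j}. snake I i k b a) \<and>
           (\<exists>g\<in>csp_dom I j. (a, g) \<in> csp_rel I i j \<and>
              (\<forall>m\<in>csp_vars I - {i, j}. arrow I j m c g))))"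

end

(* Suppose s is a solution with s i = b, and apply the SCSS condition to c = s j: it yields a value a
   and, for every other variable k, a value e k compatible with a and at least as permissive as s k
   towards all variables different from i. Moving x_i to a and every x_k to e k simultaneously is
   safe: in the pair (s k, s l) first s k and then s l can be exchanged. *)

theory Submission imports Defs begin

text \<open>Once \<open>s\<close> takes its values in the reduced domains, the cut-down relations
  impose nothing new. The assumption on \<open>i\<close> matters: outside \<open>csp_vars I\<close>
  a solution is \<open>undefined\<close>, which could equal \<open>b\<close>.\<close>

lemma csp_solution_eliminate_iff:
  assumes "i \<in> csp_vars I"
  shows "csp_solution (eliminate I i b) s \<longleftrightarrow> csp_solution I s \<and> s i \<noteq> b"
proof -
  have vars: "csp_vars (eliminate I i b) = csp_vars I"
    by (simp add: csp_vars_def eliminate_def Let_def)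
  have dom: "csp_dom (eliminate I i b) = (csp_dom I)(i := csp_dom I i - {b})"
    by (simp add: eliminate_def Let_def)
  have rel: "csp_rel (eliminate I i b) k l = csp_rel I k l \<inter>
      (csp_dom (eliminate I i b) k \<times> csp_dom (eliminate I i b) l)" for k l
    by (simp add: eliminate_def Let_def)
  have tuple: "s \<in> (\<Pi>\<^sub>E k\<in>csp_vars I. csp_dom (eliminate I i b) k) \<longleftrightarrow>
      s \<in> (\<Pi>\<^sub>E k\<in>csp_vars I. csp_dom I k) \<and> s i \<noteq> b"
    using assms unfolding dom PiE_iff by (auto split: if_splits)
  show ?thesis
    unfolding csp_solution_def vars rel using tuple by (auto simp: PiE_iff)
qed

text \<open>The arrows skip \<open>l = i\<close>, so compatibility of each \<open>e k\<close> with
  \<open>a\<close> is a separate hypothesis. Stating the rest uniformly in \<open>k\<close> hides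
  whether \<open>e k\<close> comes from a snake or from \<open>g\<close>.\<close>

lemma csp_solution_exchange:
  assumes csp: "binary_csp I" and i: "i \<in> csp_vars I" and s: "csp_solution I s"
    and a: "a \<in> csp_dom I i"
    and e: "\<And>k. k \<in> csp_vars I - {i} \<Longrightarrow>
      e k \<in> csp_dom I k \<and> (a, e k) \<in> csp_rel I i k \<and>
      (\<forall>l\<in>csp_vars I - {i, k}. arrow I k l (s k) (e k))"
  shows "csp_solution I (restrict (e(i := a)) (csp_vars I))"
proof -
  have s_dom: "s k \<in> csp_dom I k" if "k \<in> csp_vars I" for k
    using s that by (auto simp: csp_solution_def)
  have swap: "(x, y) \<in> csp_rel I k l \<Longrightarrow> (y, x) \<in> csp_rel I l k"
    if "k \<in> csp_vars I" "l \<in> csp_vars I" "k \<noteq> l" for k l x y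
  proof -
    have "csp_rel I l k = (csp_rel I k l)\<inverse>"
      using csp that unfolding binary_csp_def by blast
    then show "(x, y) \<in> csp_rel I k l \<Longrightarrow> (y, x) \<in> csp_rel I l k" by simp
  qed
  have pair: "(e k, e l) \<in> csp_rel I k l"
    if k: "k \<in> csp_vars I - {i}" and l: "l \<in> csp_vars I - {i}" and "k \<noteq> l" for k l
  proof -
    have "(s k, s l) \<in> csp_rel I k l"
      using s k l \<open>k \<noteq> l\<close> by (auto simp: csp_solution_def)
    then have "(e k, s l) \<in> csp_rel I k l"
      using e[OF k] l \<open>k \<noteq> l\<close> s_dom[of l] by (auto simp: arrow_def)
    \<comment> \<open>An arrow only changes the first component, hence the transposition. The second
      exchange applies the arrow of \<open>l\<close> at the new value \<open>e k\<close>, using that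
      arrows quantify over the whole domain of \<open>k\<close>.\<close>
    then have "(s l, e k) \<in> csp_rel I l k"
      using swap k l \<open>k \<noteq> l\<close> by blast
    then have "(e l, e k) \<in> csp_rel I l k"
      using e[OF l] e[OF k] k \<open>k \<noteq> l\<close> by (auto simp: arrow_def)
    then show ?thesis
      using swap k l \<open>k \<noteq> l\<close> by blast
  qed
  have "(e(i := a)) k \<in> csp_dom I k" if "k \<in> csp_vars I" for k
    using a e that by auto
  moreover have "((e(i := a)) k, (e(i := a)) l) \<in> csp_rel I k l"
    if "k \<in> csp_vars I" "l \<in> csp_vars I" "k \<noteq> l" for k l
    \<comment> \<open>If one index is \<open>i\<close>, the pair is \<open>(a, e l)\<close> or the
      transpose of \<open>(a, e k)\<close>.\<close>
    using that pair[of k l] e[of k] e[of l] swap[OF i, of k] by auto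
  ultimately show ?thesis
    by (auto simp: csp_solution_def)
qed

lemma SCSS_avoidable:
  assumes csp: "binary_csp I" and i: "i \<in> csp_vars I" and "SCSS I i b"
    and s: "csp_solution I s" and "s i = b"
  obtains t where "csp_solution I t" "t i \<noteq> b"
proof -
  have s_rel: "s k \<in> csp_dom I k \<and> (b, s k) \<in> csp_rel I i k" if "k \<in> csp_vars I - {i}" for k
    using s i that \<open>s i = b\<close> by (auto simp: csp_solution_def)
  obtain j where "j \<in> csp_vars I - {i}" and
    j: "\<And>c. c \<in> csp_dom I j \<Longrightarrow> (b, c) \<in> csp_rel I i j \<Longrightarrow>
      \<exists>a\<in>csp_dom I i - {b}. (\<forall>k\<in>csp_vars I - {i, j}. snake I i k b a) \<and>
        (\<exists>g\<in>csp_dom I j. (a, g) \<in> csp_rel I i j \<and> (\<forall>m\<in>csp_vars I - {i, j}. arrow I j m c g))"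
    using \<open>SCSS I i b\<close> unfolding SCSS_def by blast
  obtain a g where a: "a \<in> csp_dom I i" "a \<noteq> b"
    and snake: "\<And>k. k \<in> csp_vars I - {i, j} \<Longrightarrow> snake I i k b a"
    and g: "g \<in> csp_dom I j" "(a, g) \<in> csp_rel I i j"
      "\<forall>m\<in>csp_vars I - {i, j}. arrow I j m (s j) g"
    \<comment> \<open>In SCSS the value \<open>a\<close> may depend on \<open>c\<close>; the
      solution fixes \<open>c\<close> as \<open>s j\<close>, so a single \<open>a\<close>
      suffices.\<close>
    using j[of "s j"] s_rel[OF \<open>j \<in> csp_vars I - {i}\<close>] by blast
  \<comment> \<open>For \<open>k = j\<close> the witness is \<open>g\<close>; otherwise it is the
    one that the snake provides for \<open>s k\<close>.\<close>
  have "\<exists>d. d \<in> csp_dom I k \<and> (a, d) \<in> csp_rel I i k \<and>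
      (\<forall>l\<in>csp_vars I - {i, k}. arrow I k l (s k) d)" if k: "k \<in> csp_vars I - {i}" for k
  proof (cases "k = j")
    case True
    then show ?thesis using g by blast
  next
    case False
    then have "snake I i k b a" using snake k by blast
    then show ?thesis using s_rel[OF k] unfolding snake_def by blast
  qed
  then obtain e where "\<And>k. k \<in> csp_vars I - {i} \<Longrightarrow>
      e k \<in> csp_dom I k \<and> (a, e k) \<in> csp_rel I i k \<and>
      (\<forall>l\<in>csp_vars I - {i, k}. arrow I k l (s k) (e k))"
    by metis
  from csp_solution_exchange[OF csp i s a(1) this] show thesis
    using that i a(2) by fastforce
qed

theorem theorem1:
  fixes I :: "'a csp" and i :: nat and b :: 'a
  assumes "binary_csp I"
    and "i \<in> csp_vars I"
    and "b \<in> csp_dom I i"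
    and "SCSS I i b"
  shows "satisfiable I \<longleftrightarrow> satisfiable (eliminate I i b)"
  \<comment> \<open>What remains is to find a solution avoiding \<open>b\<close> from an arbitrary
    one, so the exchange is needed only for solutions through \<open>b\<close>.\<close>
  unfolding satisfiable_def csp_solution_eliminate_iff[OF assms(2)]
  using SCSS_avoidable[OF assms(1,2,4)] by metis

end
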